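(* Let $f,\phi:\mathbb{R}^n\to\mathbb{R}\cup\{+\infty\}$ be proper, lower semicontinuous and bounded from below, with $f$ convex and $L_f$-smooth (differentiable with $L_f$-Lipschitz gradient) and $\phi$ $M$-weakly convex. Let $F:=f+\phi$. Then for $\alpha\in(0,1)$ and a stepsize $\tau>0$ with $$\tau<\min\left(\frac{1}{\alpha L_f},\frac{\alpha}{M}\right),$$ the iterates defined from $x_0,y_0\in\mathbb{R}^n$, for $k\ge0$, by $$q_{k+1}=(1-\alpha)y_k+\alpha x_k,\qquad x_{k+1}=\mathrm{Prox}_{\tau\phi}\big(x_k-\tau\nabla f(q_{k+1})\big),\qquad y_{k+1}=(1-\alpha)y_k+\alpha x_{k+1}$$ verify: (i) $F(y_k)+\frac{\alpha}{2\tau}\left(1-\frac1\alpha\right)^2\|y_k-y_{k-1}\|^2$ is non-increasing and converges; (ii) the sequence $(y_k)$ has finite length in the sense that $\sum_{k=0}^{+\infty}\|y_{k+1}-y_k\|^2<+\infty$, and $\|y_{k+1}-y_k\|$ converges to $0$ at rate $\min_{k<K}\|y_{k+1}-y_k\|=\mathcal{O}(1/\sqrt K)$; (iii) all cluster points of the sequence $(y_k)$ are stationary points of $F$. In particular, if $\phi$ is coercive, then $(y_k)$ has a subsequence converging towards a stationary point of $F$.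
   Context: $\|\cdot\|$ is the Euclidean norm. In the stepsize condition, a quotient with zero denominator is read as $+\infty$. Proximal operator: $\mathrm{Prox}_{\tau h}(x)=\arg\min_z\frac1{2\tau}\|x-z\|^2+h(z)$. A function $h$ is $M$-weakly convex if $h+\frac M2\|\cdot\|^2$ is convex; it is coercive if $h(x)\to+\infty$ as $\|x\|\to\infty$. The Fréchet subdifferential is $\hat\partial h(x)=\{\omega:\liminf_{y\to x}\frac{h(y)-h(x)-\langle\omega,y-x\rangle}{\|x-y\|}\ge0\}$; the limiting subdifferential is $\partial h(x)=\{\omega:\exists x_k\to x,\ h(x_k)\to h(x),\ \omega_k\to\omega,\ \omega_k\in\hat\partial h(x_k)\}$. A stationary point of $F$ is a point $x$ with $0\in\partial F(x)$.
   Formalization: In (i), if F(y_k)=+∞ for every k (possible when y_0 is outside the domain of F, e.g. f=0, φ the indicator of {0}, y_0≠0), the sequence is constantly +∞; convergence is therefore taken in the extended reals, with a finite limit whenever some F(y_k) is finite. *)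

theory Defs
  imports "HOL-Analysis.Analysis" "HOL-Library.Landau_Symbols"
begin

text \<open>
  Functions into \<open>\<real> \<union> {+\<infinity>}\<close> are modelled as functions into \<^typ>\<open>ereal\<close> that never
  take the value \<open>-\<infinity>\<close>; the latter is part of \<open>proper_fun\<close>.
\<close>

definition proper_fun :: "('a \<Rightarrow> ereal) \<Rightarrow> bool" where
  "proper_fun h \<longleftrightarrow> (\<forall>x. h x \<noteq> -\<infinity>) \<and> (\<exists>x. h x \<noteq> \<infinity>)"

definition lsc_fun :: "('a::topological_space \<Rightarrow> ereal) \<Rightarrow> bool" where
  "lsc_fun h \<longleftrightarrow> (\<forall>x. h x \<le> Liminf (at x) h)"

definition bounded_from_below :: "('a \<Rightarrow> ereal) \<Rightarrow> bool" where
  "bounded_from_below h \<longleftrightarrow> (\<exists>c::real. \<forall>x. ereal c \<le> h x)"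

text \<open>
  Convexity of extended-valued functions; only meant for functions that never take the
  value \<open>-\<infinity>\<close>. At the endpoints \<open>t = 0, 1\<close> the convention \<open>0 * \<infinity> = 0\<close> of
  \<^typ>\<open>ereal\<close> makes the inequality trivial.
\<close>

definition convex_fun :: "('a::real_vector \<Rightarrow> ereal) \<Rightarrow> bool" where
  "convex_fun h \<longleftrightarrow> (\<forall>x y. \<forall>t\<in>{0..1::real}.
     h ((1 - t) *\<^sub>R x + t *\<^sub>R y) \<le> ereal (1 - t) * h x + ereal t * h y)"

definition weakly_convex :: "real \<Rightarrow> ('a::real_normed_vector \<Rightarrow> ereal) \<Rightarrow> bool" where
  "weakly_convex M h \<longleftrightarrow> convex_fun (\<lambda>x. h x + ereal (M / 2 * (norm x)\<^sup>2))"

definition coercive :: "('a::real_normed_vector \<Rightarrow> ereal) \<Rightarrow> bool" where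
  "coercive h \<longleftrightarrow> (h \<longlongrightarrow> \<infinity>) at_infinity"

text \<open>The gradient is only meaningful where \<open>h\<close> is finite and differentiable.\<close>

definition grad :: "('a::real_inner \<Rightarrow> ereal) \<Rightarrow> 'a \<Rightarrow> 'a" where
  "grad h x = (THE D. GDERIV (\<lambda>z. real_of_ereal (h z)) x :> D)"

definition smooth_fun :: "real \<Rightarrow> ('a::real_inner \<Rightarrow> ereal) \<Rightarrow> bool" where
  "smooth_fun L h \<longleftrightarrow>
     (\<forall>x. \<bar>h x\<bar> \<noteq> \<infinity>) \<and>
     (\<forall>x. \<exists>D. GDERIV (\<lambda>z. real_of_ereal (h z)) x :> D) \<and>
     L-lipschitz_on UNIV (grad h)"

definition Prox :: "real \<Rightarrow> ('a::real_normed_vector \<Rightarrow> ereal) \<Rightarrow> 'a \<Rightarrow> 'a" where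
  "Prox \<tau> h x = arg_min (\<lambda>z. ereal (1 / (2 * \<tau>) * (norm (x - z))\<^sup>2) + h z) (\<lambda>_. True)"

text \<open>
  As usual, the subdifferentials are empty outside the effective domain. The explicit
  finiteness conditions are needed because \<^typ>\<open>ereal\<close> assigns a value to
  \<open>\<infinity> - \<infinity>\<close>.
\<close>

definition frechet_subdiff :: "('a::real_inner \<Rightarrow> ereal) \<Rightarrow> 'a \<Rightarrow> 'a set" where
  "frechet_subdiff h x = {\<omega>. \<bar>h x\<bar> \<noteq> \<infinity> \<and>
     0 \<le> Liminf (at x) (\<lambda>y. (h y - h x - ereal (\<omega> \<bullet> (y - x))) / ereal (norm (x - y)))}"

definition limiting_subdiff :: "('a::real_inner \<Rightarrow> ereal) \<Rightarrow> 'a \<Rightarrow> 'a set" where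
  "limiting_subdiff h x = {\<omega>. \<bar>h x\<bar> \<noteq> \<infinity> \<and>
     (\<exists>u w. u \<longlonglongrightarrow> x \<and> (\<lambda>k. h (u k)) \<longlonglongrightarrow> h x \<and> w \<longlonglongrightarrow> \<omega> \<and>
            (\<forall>k::nat. w k \<in> frechet_subdiff h (u k)))}"

definition stationary_point :: "('a::real_inner \<Rightarrow> ereal) \<Rightarrow> 'a \<Rightarrow> bool" where
  "stationary_point h x \<longleftrightarrow> 0 \<in> limiting_subdiff h x"

definition cluster_point :: "(nat \<Rightarrow> 'a::topological_space) \<Rightarrow> 'a \<Rightarrow> bool" where
  "cluster_point s p \<longleftrightarrow> (\<exists>r::nat \<Rightarrow> nat. strict_mono r \<and> (s \<circ> r) \<longlonglongrightarrow> p)"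

end

theory Submission
  imports Defs
begin

text \<open>
  Write \<open>u\<close> for the current \<open>x\<close>, \<open>p\<close> for the next one, \<open>Y\<close> for the current \<open>y\<close>. The energy
  \<open>F(Y) + \<alpha>/(2\<tau>) \<parallel>Y - u\<parallel>\<^sup>2\<close> decreases along the iteration by a multiple of
  \<open>\<parallel>Y - p\<parallel>\<^sup>2\<close> (lemma \<open>relaxed_step_descent\<close>), and everything else follows from that.
  Four inequalities add up to this decrease: convexity of \<open>f\<close> between the extrapolated point and
  \<open>Y\<close>; the quadratic upper bound for \<open>f\<close> between the extrapolated point and the new \<open>y\<close>; weak
  convexity of \<open>\<phi>\<close> on the segment from \<open>Y\<close> to \<open>p\<close>; and the optimality of \<open>p\<close> as a proximal point,
  tested at \<open>Y\<close> (lemma \<open>Prox_quadratic_minorant\<close>). Since the new \<open>y\<close> lies on that segment and the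
  extrapolated point on the one from \<open>Y\<close> to \<open>u\<close>, the gradient terms cancel. The bound
  \<open>\<tau> \<le> 1/(\<alpha> L)\<close> absorbs the curvature of \<open>f\<close>, and \<open>\<tau> < \<alpha>/M\<close> makes the remaining coefficient of
  \<open>\<parallel>Y - p\<parallel>\<^sup>2\<close> strictly negative. As \<open>Y - u\<close> and \<open>Y - p\<close> are multiples of the increments of
  \<open>y\<close>, the energy is the quantity in the first claim, and the decrease bounds the sum of the
  squared increments.

  The argument needs \<open>\<phi>\<close> to be finite at \<open>Y\<close>. If \<open>y 0\<close> lies outside the domain of \<open>\<phi>\<close>, then the whole
  sequence \<open>y\<close> may stay outside, so that the first claim is trivial while the others are not.
  For these, \<open>y\<close> is replaced by a shadow sequence that obeys the same averaging recursion but starts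
  at \<open>x 1\<close>, which is a proximal point. It stays in the domain because the domain is convex, and its
  distance to \<open>y\<close> decays geometrically. The gradients are still taken at the original extrapolated
  points; this costs an error proportional to that distance times \<open>\<parallel>Y - p\<parallel>\<close>, which Young's
  inequality splits into half of the decrease and a summable term (lemma \<open>shadow_energy\<close>).

  For the cluster points, \<open>Prox_quadratic_minorant\<close> gives a Frechet subgradient of \<open>F\<close> at each
  \<open>x\<close>. It tends to \<open>0\<close> because all gaps between \<open>x\<close>, \<open>y\<close> and \<open>q\<close> do, and a uniform quadratic minorant
  forces the values of \<open>\<phi>\<close> to converge as well (lemma \<open>quadratic_minorant_limit\<close>).
\<close>

section \<open>Lower semicontinuity and proximal points\<close>

text \<open>
  The inferior limit in the definition is taken over punctured neighbourhoods; at the point itself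
  the inequality is the hypothesis.
\<close>

lemma lsc_eventually_less:
  fixes h :: "'a::topological_space \<Rightarrow> ereal"
  assumes "lsc_fun h" "b < h z"
  shows "eventually (\<lambda>w. b < h w) (nhds z)"
proof -
  have "eventually (\<lambda>w. b < h w) (at z)"
    using assms unfolding lsc_fun_def le_Liminf_iff by blast
  then show ?thesis
    using assms(2) by (auto simp: eventually_at_filter elim: eventually_mono)
qed

lemma lsc_le_limit:
  fixes h :: "'a::topological_space \<Rightarrow> ereal"
  assumes lsc: "lsc_fun h" and u: "u \<longlonglongrightarrow> z" and a: "a \<longlonglongrightarrow> l"
    and le: "eventually (\<lambda>n. h (u n) \<le> a n) sequentially"
  shows "h z \<le> l"
proof (rule ccontr)
  assume "\<not> h z \<le> l"
  then obtain b where b: "l < b" "b < h z"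
    using dense[of l "h z"] by (auto simp: not_le)
  have "eventually (\<lambda>n. b < h (u n)) sequentially"
    using eventually_compose_filterlim[OF lsc_eventually_less[OF lsc b(2)] u] .
  moreover have "eventually (\<lambda>n. a n < b) sequentially"
    using order_tendstoD(2)[OF a b(1)] .
  ultimately have "eventually (\<lambda>n. False) sequentially"
    using le by eventually_elim auto
  then show False by simp
qed

text \<open>
  The choice operator in \<open>Prox\<close> yields a minimiser only if there is one. A minimiser exists because the quadratic term makes a minimising sequence bounded: \<open>\<phi>\<close> is bounded below, so
  \<open>\<parallel>u - z\<parallel>\<^sup>2\<close> is bounded on sublevel sets. Lower semicontinuity passes to the limit of a subsequence.
\<close>

lemma Prox_minimises:
  fixes \<phi> :: "'a::euclidean_space \<Rightarrow> ereal"
  assumes "proper_fun \<phi>" "lsc_fun \<phi>" "bounded_from_below \<phi>" "0 < \<tau>"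
  shows "ereal (1 / (2 * \<tau>) * (norm (u - Prox \<tau> \<phi> u))\<^sup>2) + \<phi> (Prox \<tau> \<phi> u)
         \<le> ereal (1 / (2 * \<tau>) * (norm (u - z))\<^sup>2) + \<phi> z"
proof -
  define J where "J z = ereal (1 / (2 * \<tau>) * (norm (u - z))\<^sup>2) + \<phi> z" for z
  obtain c where c: "\<And>z. ereal c \<le> \<phi> z"
    using assms(3) unfolding bounded_from_below_def by auto
  have Jc: "ereal c \<le> J z" for z
    unfolding J_def using c[of z] assms(4)
    by (metis add_increasing ereal_less_eq(5) zero_le_divide_1_iff mult_nonneg_nonneg
        zero_le_power2 less_imp_le zero_le_numeral)
  obtain z0 where z0: "\<phi> z0 \<noteq> \<infinity>"
    using assms(1) unfolding proper_fun_def by auto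
  have INF_lower: "(INF z. J z) \<le> J z" for z by (rule INF_lower) simp
  have "ereal c \<le> (INF z. J z)" by (rule INF_greatest) (rule Jc)
  moreover have "(INF z. J z) < \<infinity>"
    using INF_lower[of z0] z0 by (auto simp: J_def less_top[symmetric] top_ereal_def)
  ultimately obtain m where m: "(INF z. J z) = ereal m"
    by (cases "INF z. J z") auto
  have "\<exists>z. J z < ereal (m + 1 / real (Suc n))" for n
    using m by (metis INF_less_iff UNIV_I divide_pos_pos ereal_less(2) ereal_less_eq(3)
        less_add_same_cancel1 less_ereal.simps(1) of_nat_0_less_iff zero_less_Suc zero_less_one)
  then obtain s where s: "\<And>n. J (s n) < ereal (m + 1 / real (Suc n))"
    by metis
  have "dist u (s n) \<le> sqrt (2 * \<tau> * (m + 1 - c))" for n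
  proof -
    have "ereal (1 / (2 * \<tau>) * (norm (u - s n))\<^sup>2) + ereal c \<le> J (s n)"
      unfolding J_def using c by (intro add_left_mono)
    also have "\<dots> < ereal (m + 1 / real (Suc n))" by (rule s)
    finally have "1 / (2 * \<tau>) * (norm (u - s n))\<^sup>2 + c < m + 1 / real (Suc n)" by simp
    also have "\<dots> \<le> m + 1" by (simp add: divide_le_eq)
    finally have "(norm (u - s n))\<^sup>2 \<le> 2 * \<tau> * (m + 1 - c)"
      using assms(4) by (simp add: field_simps)
    then show ?thesis by (simp add: dist_norm real_le_rsqrt)
  qed
  then have "bounded (range s)" by (auto simp: bounded_def)
  then obtain p r where r: "strict_mono r" and p: "(s \<circ> r) \<longlonglongrightarrow> p"
    using bounded_imp_convergent_subsequence by blast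
  have "(\<lambda>n. 1 / real (Suc (r n))) \<longlonglongrightarrow> 0"
    using LIMSEQ_subseq_LIMSEQ[OF LIMSEQ_inverse_real_of_nat r]
    by (simp add: o_def inverse_eq_divide)
  then have lim: "(\<lambda>n. ereal (m + 1 / real (Suc (r n)) - 1 / (2 * \<tau>) * (norm (u - s (r n)))\<^sup>2))
      \<longlonglongrightarrow> ereal (m + 0 - 1 / (2 * \<tau>) * (norm (u - p))\<^sup>2)"
    using p unfolding o_def lim_ereal by (intro tendsto_intros)
  have "\<phi> (s (r n)) \<le> ereal (m + 1 / real (Suc (r n)) - 1 / (2 * \<tau>) * (norm (u - s (r n)))\<^sup>2)" for n
    using s[of "r n"] unfolding J_def by (cases "\<phi> (s (r n))") auto
  then have "\<phi> p \<le> ereal (m + 0 - 1 / (2 * \<tau>) * (norm (u - p))\<^sup>2)"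
    using lsc_le_limit[OF assms(2) p[unfolded o_def] lim] by simp
  then have "J p \<le> ereal m" unfolding J_def by (cases "\<phi> p") auto
  then have "is_arg_min J (\<lambda>_. True) p"
    using INF_lower m by (auto simp: is_arg_min_def not_less intro: order_trans)
  then have "is_arg_min J (\<lambda>_. True) (arg_min J (\<lambda>_. True))"
    unfolding arg_min_def by (rule someI)
  moreover have "Prox \<tau> \<phi> u = arg_min J (\<lambda>_. True)"
    unfolding Prox_def J_def ..
  ultimately have "J (Prox \<tau> \<phi> u) \<le> J z"
    by (auto simp: is_arg_min_def not_less)
  then show ?thesis unfolding J_def .
qed

text \<open>
  This identity is the reason why weak convexity is equivalent to convexity up to a multiple of
  \<open>t (1 - t) \<parallel>a - b\<parallel>\<^sup>2\<close>.
\<close>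

lemma norm_sq_convex_combination:
  fixes a b :: "'a::real_inner"
  shows "(norm ((1 - t) *\<^sub>R a + t *\<^sub>R b))\<^sup>2
    = (1 - t) * (norm a)\<^sup>2 + t * (norm b)\<^sup>2 - t * (1 - t) * (norm (a - b))\<^sup>2"
  unfolding power2_norm_eq_inner
  by (simp add: inner_commute algebra_simps)

lemma weakly_convex_ineq:
  fixes h :: "'a::real_inner \<Rightarrow> ereal"
  assumes "weakly_convex M h" "\<And>z. h z \<noteq> -\<infinity>" "h a \<noteq> \<infinity>" "h b \<noteq> \<infinity>" "0 \<le> t" "t \<le> 1"
  shows "h ((1 - t) *\<^sub>R a + t *\<^sub>R b) \<le> ereal ((1 - t) * real_of_ereal (h a)
      + t * real_of_ereal (h b) + t * (1 - t) * (M / 2) * (norm (a - b))\<^sup>2)"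
proof -
  obtain ra rb where ra: "h a = ereal ra" and rb: "h b = ereal rb"
    using assms(2-4) by (metis ereal_cases)
  let ?z = "(1 - t) *\<^sub>R a + t *\<^sub>R b"
  have "h ?z + ereal (M / 2 * (norm ?z)\<^sup>2)
     \<le> ereal (1 - t) * (h a + ereal (M / 2 * (norm a)\<^sup>2)) + ereal t * (h b + ereal (M / 2 * (norm b)\<^sup>2))"
    using assms(1,5,6) unfolding weakly_convex_def convex_fun_def by force
  then show ?thesis
    unfolding ra rb norm_sq_convex_combination[of t a b]
    by (cases "h ?z") (simp_all add: field_simps)
qed

lemma Prox_finite:
  fixes \<phi> :: "'a::euclidean_space \<Rightarrow> ereal"
  assumes "proper_fun \<phi>" "lsc_fun \<phi>" "bounded_from_below \<phi>" "0 < \<tau>"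
  shows "\<phi> (Prox \<tau> \<phi> u) \<noteq> \<infinity>"
proof -
  obtain z where "\<phi> z \<noteq> \<infinity>"
    using assms(1) unfolding proper_fun_def by auto
  then show ?thesis
    using Prox_minimises[OF assms, of u z] by auto
qed

text \<open>
  Comparing \<open>p\<close> with the points \<open>w = (1 - t) p + t z\<close> of a segment, dividing by \<open>t\<close> and letting
  \<open>t\<close> tend to \<open>0\<close> turns global minimality into a subgradient inequality, global up to the defect of
  convexity. This single inequality is used both for the descent and for stationarity.
\<close>

lemma Prox_quadratic_minorant:
  fixes \<phi> :: "'a::euclidean_space \<Rightarrow> ereal" and u :: 'a
  assumes \<phi>: "proper_fun \<phi>" "lsc_fun \<phi>" "bounded_from_below \<phi>" "weakly_convex M \<phi>" and "0 < \<tau>"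
  defines "p \<equiv> Prox \<tau> \<phi> u"
  shows "\<phi> p + ereal (((u - p) /\<^sub>R \<tau>) \<bullet> (z - p) - M / 2 * (norm (z - p))\<^sup>2) \<le> \<phi> z"
proof (cases "\<phi> z = \<infinity>")
  case False
  have notm: "\<And>z. \<phi> z \<noteq> -\<infinity>" using \<phi>(1) unfolding proper_fun_def by auto
  have "\<phi> p \<noteq> \<infinity>" unfolding p_def using Prox_finite \<phi> \<open>0 < \<tau>\<close> by blast
  then obtain rp rz where rp: "\<phi> p = ereal rp" and rz: "\<phi> z = ereal rz"
    using notm False by (metis ereal_cases)
  define i where "i = (u - p) \<bullet> (z - p)"
  define c where "c = i / \<tau>"
  have c_eq: "((u - p) /\<^sub>R \<tau>) \<bullet> (z - p) = c"
    by (simp add: c_def i_def divide_inverse)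
  define n where "n = (norm (z - p))\<^sup>2"
  have seg: "rp + c - (M / 2) * n + t * (M / 2 - 1 / (2 * \<tau>)) * n \<le> rz" if t: "0 < t" "t < 1" for t
  proof -
    let ?w = "(1 - t) *\<^sub>R p + t *\<^sub>R z"
    have "ereal (1 / (2 * \<tau>) * (norm (u - p))\<^sup>2) + \<phi> p \<le> ereal (1 / (2 * \<tau>) * (norm (u - ?w))\<^sup>2) + \<phi> ?w"
      unfolding p_def by (rule Prox_minimises[OF \<phi>(1-3) \<open>0 < \<tau>\<close>])
    also have "\<dots> \<le> ereal (1 / (2 * \<tau>) * (norm (u - ?w))\<^sup>2)
        + ereal ((1 - t) * rp + t * rz + t * (1 - t) * (M / 2) * n)"
      using weakly_convex_ineq[OF \<phi>(4) notm, of p z t] t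
      by (intro add_left_mono) (simp add: rp rz n_def norm_minus_commute)
    finally have 1: "1 / (2 * \<tau>) * (norm (u - p))\<^sup>2 + rp
        \<le> 1 / (2 * \<tau>) * (norm (u - ?w))\<^sup>2 + ((1 - t) * rp + t * rz + t * (1 - t) * (M / 2) * n)"
      by (simp add: rp)
    have "u - ?w = (u - p) - t *\<^sub>R (z - p)" by (simp add: algebra_simps)
    then have "(norm (u - ?w))\<^sup>2 = (norm (u - p))\<^sup>2 - 2 * t * i + t\<^sup>2 * n"
      unfolding n_def i_def
      by (simp only: power2_norm_eq_inner)
         (simp add: inner_commute inner_diff_left inner_diff_right algebra_simps power2_eq_square)
    then have "1 / (2 * \<tau>) * (norm (u - ?w))\<^sup>2
        = 1 / (2 * \<tau>) * (norm (u - p))\<^sup>2 - t * c + t * (t * (1 / (2 * \<tau>)) * n)"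
      using \<open>0 < \<tau>\<close> unfolding c_def by (simp add: right_diff_distrib distrib_left power2_eq_square)
    with 1 have "rp \<le> - t * c + t * (t * (1 / (2 * \<tau>)) * n)
        + ((1 - t) * rp + t * rz + t * (1 - t) * (M / 2) * n)"
      by linarith
    then have "t * (rp + c - (M / 2) * n + t * (M / 2 - 1 / (2 * \<tau>)) * n) \<le> t * rz"
      by (simp add: algebra_simps add_divide_distrib diff_divide_distrib)
    then show ?thesis using t(1) by simp
  qed
  have "((\<lambda>t. rp + c - (M / 2) * n + t * (M / 2 - 1 / (2 * \<tau>)) * n)
      \<longlongrightarrow> rp + c - (M / 2) * n + 0 * (M / 2 - 1 / (2 * \<tau>)) * n) (at_right 0)"
    by (intro tendsto_intros)
  moreover have "eventually (\<lambda>t. rp + c - (M / 2) * n + t * (M / 2 - 1 / (2 * \<tau>)) * n \<le> rz) (at_right (0::real))"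
    using seg by (auto simp: eventually_at_right_field intro: exI[of _ 1])
  ultimately have "rp + c - (M / 2) * n \<le> rz"
    using tendsto_upperbound[of _ _ "at_right (0::real)"] by fastforce
  then show ?thesis unfolding rp rz c_eq n_def[symmetric] by simp
qed simp

section \<open>Smooth and convex functions\<close>

text \<open>
  Gradients are unique, so the definite description in \<open>grad\<close> denotes one.
\<close>

lemma GDERIV_grad:
  fixes f :: "'a::real_inner \<Rightarrow> ereal"
  assumes "smooth_fun L f"
  shows "GDERIV (\<lambda>z. real_of_ereal (f z)) x :> grad f x"
proof -
  obtain D where D: "GDERIV (\<lambda>z. real_of_ereal (f z)) x :> D"
    using assms unfolding smooth_fun_def by blast
  have "D' = D" if "GDERIV (\<lambda>z. real_of_ereal (f z)) x :> D'" for D'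
  proof -
    have "(\<lambda>h. h \<bullet> D') = (\<lambda>h. h \<bullet> D)"
      using has_derivative_unique that D unfolding gderiv_def by blast
    then have "\<forall>h. h \<bullet> D' = h \<bullet> D" by (simp add: fun_eq_iff)
    then show ?thesis by (simp only: vector_eq_ldot)
  qed
  then have "grad f x = D" unfolding grad_def using D by blast
  then show ?thesis using D by simp
qed

lemma GDERIV_along_line:
  fixes g :: "'a::real_inner \<Rightarrow> real"
  assumes "GDERIV g (w + t *\<^sub>R d) :> D"
  shows "((\<lambda>t. g (w + t *\<^sub>R d)) has_real_derivative D \<bullet> d) (at t)"
proof -
  have "((\<lambda>t. w + t *\<^sub>R d) has_derivative (\<lambda>s. s *\<^sub>R d)) (at t)"
    by (auto intro!: derivative_eq_intros)
  from has_derivative_compose[OF this assms[unfolded gderiv_def]]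
  show ?thesis unfolding has_field_derivative_def
    by (simp add: inner_commute mult_commute_abs)
qed

text \<open>
  Along the segment, subtracting the right-hand side leaves a function with nonpositive derivative.
\<close>

lemma smooth_upper_bound:
  fixes g :: "'a::real_inner \<Rightarrow> real"
  assumes g: "\<And>x. GDERIV g x :> G x" and lip: "L-lipschitz_on UNIV G"
  shows "g z \<le> g w + G w \<bullet> (z - w) + L / 2 * (norm (z - w))\<^sup>2"
proof -
  let ?d = "z - w"
  let ?h = "\<lambda>t. g (w + t *\<^sub>R ?d) - t * (G w \<bullet> ?d) - L / 2 * t\<^sup>2 * (norm ?d)\<^sup>2"
  have "?h 1 \<le> ?h 0"
  proof (rule DERIV_nonpos_imp_nonincreasing[of 0 1 ?h])
    fix t :: real assume t: "0 \<le> t" "t \<le> 1"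
    let ?y = "G (w + t *\<^sub>R ?d) \<bullet> ?d - G w \<bullet> ?d - L * t * (norm ?d)\<^sup>2"
    have "(?h has_real_derivative ?y) (at t)"
      by (auto intro!: derivative_eq_intros GDERIV_along_line g simp: power2_eq_square)
    moreover have "?y \<le> 0"
    proof -
      have "(G (w + t *\<^sub>R ?d) - G w) \<bullet> ?d \<le> norm (G (w + t *\<^sub>R ?d) - G w) * norm ?d"
        by (rule norm_cauchy_schwarz)
      also have "\<dots> \<le> (L * norm (t *\<^sub>R ?d)) * norm ?d"
        using lipschitz_onD[OF lip, of "w + t *\<^sub>R ?d" w]
        by (intro mult_right_mono) (auto simp: dist_norm)
      finally show ?thesis using t by (simp add: inner_diff_left power2_eq_square)
    qed
    ultimately show "\<exists>y. (?h has_real_derivative y) (at t) \<and> y \<le> 0" by blast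
  qed simp
  then show ?thesis by simp
qed

text \<open>
  Convexity bounds the difference quotients at \<open>w\<close> in direction \<open>z - w\<close> by \<open>g z - g w\<close>.
\<close>

lemma convex_gradient_lower_bound:
  fixes g :: "'a::real_inner \<Rightarrow> real"
  assumes g: "GDERIV g w :> D"
    and conv: "\<And>t. 0 \<le> t \<Longrightarrow> t \<le> 1 \<Longrightarrow> g ((1 - t) *\<^sub>R w + t *\<^sub>R z) \<le> (1 - t) * g w + t * g z"
  shows "g w + D \<bullet> (z - w) \<le> g z"
proof -
  have "((\<lambda>t. g (w + t *\<^sub>R (z - w))) has_real_derivative D \<bullet> (z - w)) (at 0)"
    using g by (intro GDERIV_along_line) simp
  then have "((\<lambda>t. (g (w + t *\<^sub>R (z - w)) - g w) / t) \<longlongrightarrow> D \<bullet> (z - w)) (at_right 0)"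
    unfolding has_field_derivative_iff by (simp add: filterlim_at_split)
  moreover have "(g (w + t *\<^sub>R (z - w)) - g w) / t \<le> g z - g w" if "0 < t" "t < 1" for t
  proof -
    have "w + t *\<^sub>R (z - w) = (1 - t) *\<^sub>R w + t *\<^sub>R z" by (simp add: algebra_simps)
    then show ?thesis using conv[of t] that by (simp add: field_simps)
  qed
  then have "eventually (\<lambda>t. (g (w + t *\<^sub>R (z - w)) - g w) / t \<le> g z - g w) (at_right 0)"
    by (auto simp: eventually_at_right_field intro: exI[of _ 1])
  ultimately have "D \<bullet> (z - w) \<le> g z - g w"
    using tendsto_upperbound[of _ _ "at_right (0::real)"] by fastforce
  then show ?thesis by simp
qed

section \<open>Subgradients from quadratic minorants\<close>

text \<open>
  After division by the distance, the quadratic defect is still of first order and vanishes in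
  the limit.
\<close>

lemma frechet_subdiff_quadratic_minorant:
  fixes h :: "'a::euclidean_space \<Rightarrow> ereal"
  assumes fin: "\<bar>h p\<bar> \<noteq> \<infinity>"
    and minorant: "\<And>z. h p + ereal (\<omega> \<bullet> (z - p) - C * (norm (z - p))\<^sup>2) \<le> h z"
  shows "\<omega> \<in> frechet_subdiff h p"
proof -
  obtain rp where rp: "h p = ereal rp" using fin by auto
  have "ereal (- C * norm (p - z)) \<le> (h z - h p - ereal (\<omega> \<bullet> (z - p))) / ereal (norm (p - z))"
    if "z \<noteq> p" for z
  proof (cases "h z")
    case (real r)
    have "rp + (\<omega> \<bullet> (z - p) - C * (norm (z - p))\<^sup>2) \<le> r"
      using minorant[of z] by (simp add: rp real)
    then show ?thesis using that
      by (simp add: rp real norm_minus_commute pos_le_divide_eq power2_eq_square algebra_simps)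
  next
    case PInf
    then show ?thesis using that by (simp add: rp)
  next
    case MInf
    then show ?thesis using minorant[of z] by (simp add: rp)
  qed
  then have "Liminf (at p) (\<lambda>z. ereal (- C * norm (p - z)))
     \<le> Liminf (at p) (\<lambda>y. (h y - h p - ereal (\<omega> \<bullet> (y - p))) / ereal (norm (p - y)))"
    by (intro Liminf_mono) (auto simp: eventually_at_filter)
  moreover have "((\<lambda>z. - C * norm (p - z)) \<longlongrightarrow> - C * norm (p - p)) (at p)"
    by (intro tendsto_intros)
  then have "Liminf (at p) (\<lambda>z. ereal (- C * norm (p - z))) = ereal (- C * norm (p - p))"
    by (intro lim_imp_Liminf) (auto simp: lim_ereal)
  ultimately show ?thesis unfolding frechet_subdiff_def using fin by (simp add: zero_ereal_def)
qed

text \<open>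
  Lower semicontinuity controls the values from below. For the control from above, the minorant at
  \<open>u n\<close> is evaluated at a fixed point: first at any point of the domain, which bounds the values and
  shows that \<open>h p\<close> is finite, and then at \<open>p\<close> itself, where the correction vanishes in the limit.
\<close>

lemma quadratic_minorant_limit:
  fixes h :: "'a::euclidean_space \<Rightarrow> ereal"
  assumes h: "proper_fun h" "lsc_fun h"
    and minorant: "\<And>n z. h (u n) + ereal (v n \<bullet> (z - u n) - C * (norm (z - u n))\<^sup>2) \<le> h z"
    and u: "u \<longlonglongrightarrow> p" and v: "v \<longlonglongrightarrow> w"
  shows "\<bar>h p\<bar> \<noteq> \<infinity>" and "(\<lambda>n. h (u n)) \<longlonglongrightarrow> h p"
proof -
  define e where "e z n = v n \<bullet> (z - u n) - C * (norm (z - u n))\<^sup>2" for z n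
  have notm: "h z \<noteq> -\<infinity>" for z using h(1) by (simp add: proper_fun_def)
  have e: "(\<lambda>n. ereal (r - e z n)) \<longlonglongrightarrow> ereal (r - (w \<bullet> (z - p) - C * (norm (z - p))\<^sup>2))" for r z
    unfolding e_def lim_ereal by (intro tendsto_intros u v)
  have le: "h (u n) \<le> ereal (r - e z n)" if "h z = ereal r" for n r z
    using minorant[of n z] that by (cases "h (u n)") (auto simp: e_def)
  obtain z r where z: "h z = ereal r"
    using h(1) unfolding proper_fun_def by (metis ereal_cases)
  have "h p \<le> ereal (r - (w \<bullet> (z - p) - C * (norm (z - p))\<^sup>2))"
    by (rule lsc_le_limit[OF h(2) u e]) (simp add: le[OF z])
  then show fin: "\<bar>h p\<bar> \<noteq> \<infinity>" using notm[of p] by auto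
  then obtain rp where rp: "h p = ereal rp" by auto
  show "(\<lambda>n. h (u n)) \<longlonglongrightarrow> h p"
  proof (rule order_tendstoI)
    fix a assume "a < h p"
    from eventually_compose_filterlim[OF lsc_eventually_less[OF h(2) this] u]
    show "eventually (\<lambda>n. a < h (u n)) sequentially" .
  next
    fix a assume "h p < a"
    moreover have "(\<lambda>n. ereal (rp - e p n)) \<longlonglongrightarrow> h p" using e[of rp p] by (simp add: rp)
    ultimately have "eventually (\<lambda>n. ereal (rp - e p n) < a) sequentially"
      using order_tendstoD(2) by blast
    then show "eventually (\<lambda>n. h (u n) < a) sequentially"
      by (rule eventually_mono) (use le[OF rp] in \<open>auto intro: le_less_trans\<close>)
  qed
qed

section \<open>Summability and rates\<close>

text \<open>
  A sequence that decreases up to summable errors. Telescoping gives both conclusions.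
\<close>

lemma quasi_descent:
  fixes E d b :: "nat \<Rightarrow> real"
  assumes step: "\<And>k. E (Suc k) + d k \<le> E k + b k" and d: "\<And>k. 0 \<le> d k"
    and b: "\<And>k. 0 \<le> b k" "summable b" and E: "\<And>k. m \<le> E k"
  shows "summable d" and "E k \<le> E 0 + suminf b"
proof -
  have *: "E n + sum d {..<n} \<le> E 0 + suminf b" for n
  proof -
    have "E n + sum d {..<n} \<le> E 0 + sum b {..<n}"
    proof (induction n)
      case (Suc n)
      then show ?case using step[of n] by simp
    qed simp
    also have "sum b {..<n} \<le> suminf b" using b by (intro sum_le_suminf) auto
    finally show ?thesis by simp
  qed
  show "summable d"
  proof (rule summableI_nonneg_bounded)
    show "sum d {..<n} \<le> E 0 + suminf b - m" for n using *[of n] E[of n] by linarith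
  qed (rule d)
  have "0 \<le> sum d {..<k}" using d by (simp add: sum_nonneg)
  then show "E k \<le> E 0 + suminf b" using *[of k] by linarith
qed

text \<open>
  \<open>K\<close> times the square of the minimum is at most the sum of the squares.
\<close>

lemma Min_bigo_of_square_summable:
  fixes a :: "nat \<Rightarrow> real"
  assumes a: "\<And>k. 0 \<le> a k" and s: "summable (\<lambda>k. (a k)\<^sup>2)"
  shows "(\<lambda>K. Min (a ` {..<K})) \<in> O(\<lambda>K. 1 / sqrt (real K))"
proof (rule bigoI[of _ "sqrt (suminf (\<lambda>k. (a k)\<^sup>2))"], rule eventually_sequentiallyI[of 1])
  fix K :: nat assume K: "1 \<le> K"
  let ?S = "suminf (\<lambda>k. (a k)\<^sup>2)" and ?m = "Min (a ` {..<K})"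
  have ne: "a ` {..<K} \<noteq> {}" using K by (auto simp: lessThan_empty_iff)
  have m0: "0 \<le> ?m" using ne a by (subst Min_ge_iff) auto
  have "real K * ?m\<^sup>2 = (\<Sum>k<K. ?m\<^sup>2)" by simp
  also have "\<dots> \<le> (\<Sum>k<K. (a k)\<^sup>2)"
    using m0 by (intro sum_mono power_mono) auto
  also have "\<dots> \<le> ?S" using s by (intro sum_le_suminf) auto
  finally have "?m\<^sup>2 \<le> ?S / real K" using K by (simp add: field_simps)
  then have "?m \<le> sqrt (?S / real K)" by (rule real_le_rsqrt)
  then show "norm ?m \<le> sqrt ?S * norm (1 / sqrt (real K))"
    using m0 by (simp add: real_sqrt_divide)
qed

section \<open>Descent of one relaxed proximal gradient step\<close>

text \<open>
  The gradient \<open>G q\<close> may be taken at a point \<open>q\<close> other than the extrapolated point \<open>q'\<close>; the last term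
  of the bound accounts for that, and vanishes for \<open>q = q'\<close>. The reals \<open>hY\<close>, \<open>hp\<close>, \<open>hY'\<close> stand for the
  values of \<open>\<phi>\<close> at \<open>Y\<close>, \<open>p\<close> and \<open>Y'\<close>. In terms of \<open>a = x - p\<close> and \<open>b = Y - p\<close> the gradient terms of \<open>lower\<close>
  and \<open>upper\<close> combine to \<open>- \<alpha> G q' \<bullet> b\<close>, and \<open>sub\<close> contributes \<open>\<alpha> G q \<bullet> b\<close>. The remaining inner product
  \<open>a \<bullet> b\<close> is polarised. This yields the old distance term \<open>\<parallel>b - a\<parallel>\<^sup>2\<close>, the term in
  \<open>\<parallel>a\<parallel>\<^sup>2\<close> that absorbs the curvature of \<open>g\<close>, and a multiple of \<open>\<parallel>b\<parallel>\<^sup>2\<close>. Only the fraction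
  \<open>(1 - \<alpha>)\<^sup>2\<close> of the latter is needed for the new distance term, because \<open>Y' - p = (1 - \<alpha>) b\<close>.
\<close>

lemma relaxed_step_descent:
  fixes g :: "'a::real_inner \<Rightarrow> real" and G :: "'a \<Rightarrow> 'a" and Y x p q :: 'a and \<alpha> :: real
  defines "q' \<equiv> (1 - \<alpha>) *\<^sub>R Y + \<alpha> *\<^sub>R x" and "Y' \<equiv> (1 - \<alpha>) *\<^sub>R Y + \<alpha> *\<^sub>R p"
  assumes \<alpha>: "0 < \<alpha>" "\<alpha> < 1" and \<tau>: "0 < \<tau>" "\<tau> * (\<alpha> * L) \<le> 1"
    and lower: "g q' + G q' \<bullet> (Y - q') \<le> g Y"
    and upper: "g Y' \<le> g q' + G q' \<bullet> (Y' - q') + L / 2 * (norm (Y' - q'))\<^sup>2"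
    and lip: "norm (G q - G q') \<le> L * norm (q - q')"
    and mid: "hY' \<le> (1 - \<alpha>) * hY + \<alpha> * hp + \<alpha> * (1 - \<alpha>) * (M / 2) * (norm (Y - p))\<^sup>2"
    and sub: "hp + ((x - \<tau> *\<^sub>R G q - p) /\<^sub>R \<tau>) \<bullet> (Y - p) - M / 2 * (norm (Y - p))\<^sup>2 \<le> hY"
  shows "g Y' + hY' + \<alpha> / (2 * \<tau>) * (norm (Y' - p))\<^sup>2
           + \<alpha> * (2 - \<alpha>) / 2 * (\<alpha> / \<tau> - M) * (norm (Y - p))\<^sup>2
         \<le> g Y + hY + \<alpha> / (2 * \<tau>) * (norm (Y - x))\<^sup>2 + \<alpha> * L * norm (q - q') * norm (Y - p)"
proof -
  define a b where "a = x - p" and "b = Y - p"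
  have Yx: "Y - x = b - a" by (simp add: a_def b_def)
  have d1: "Y - q' = \<alpha> *\<^sub>R (b - a)" "Y' - q' = - \<alpha> *\<^sub>R a" "Y' - p = (1 - \<alpha>) *\<^sub>R b"
    by (simp_all add: q'_def Y'_def a_def b_def algebra_simps)
  have s: "((x - \<tau> *\<^sub>R G q - p) /\<^sub>R \<tau>) \<bullet> (Y - p) = (a \<bullet> b) / \<tau> - G q \<bullet> b"
  proof -
    have "x - \<tau> *\<^sub>R G q - p = a - \<tau> *\<^sub>R G q" by (simp add: a_def)
    then show ?thesis
      unfolding b_def[symmetric] using \<tau>(1)
      by (simp only: inner_scaleR_left inner_diff_left[of a]) (simp add: divide_inverse right_diff_distrib)
  qed
  have pol: "a \<bullet> b = ((norm a)\<^sup>2 + (norm b)\<^sup>2 - (norm (b - a))\<^sup>2) / 2"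
    unfolding power2_norm_eq_inner by (simp add: inner_commute algebra_simps)
  have 1: "g q' + \<alpha> * (G q' \<bullet> b) - \<alpha> * (G q' \<bullet> a) \<le> g Y"
    using lower unfolding d1 by (simp add: algebra_simps)
  have 2: "g Y' \<le> g q' - \<alpha> * (G q' \<bullet> a) + L / 2 * \<alpha>\<^sup>2 * (norm a)\<^sup>2"
    using upper \<alpha> unfolding d1 by (simp add: algebra_simps power_mult_distrib)
  have 3: "\<alpha> * hp \<le> \<alpha> * (hY - (a \<bullet> b) / \<tau> + G q \<bullet> b + M / 2 * (norm b)\<^sup>2)"
    using sub[unfolded s, folded b_def] \<alpha> by (intro mult_left_mono) auto
  have "(G q - G q') \<bullet> b \<le> norm (G q - G q') * norm b" by (rule norm_cauchy_schwarz)
  also have "\<dots> \<le> L * norm (q - q') * norm b" using lip by (rule mult_right_mono) simp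
  finally have "\<alpha> * ((G q - G q') \<bullet> b) \<le> \<alpha> * (L * norm (q - q') * norm b)"
    using \<alpha> by (intro mult_left_mono) auto
  then have 4: "\<alpha> * (G q \<bullet> b) - \<alpha> * (G q' \<bullet> b) \<le> \<alpha> * L * norm (q - q') * norm b"
    by (simp add: algebra_simps)
  have "\<alpha> * L \<le> 1 / \<tau>" using \<tau> by (simp add: field_simps)
  then have "\<alpha> / 2 * (\<alpha> * L) \<le> \<alpha> / 2 * (1 / \<tau>)"
    using \<alpha> by (intro mult_left_mono) auto
  then have "\<alpha> / 2 * (\<alpha> * L) * (norm a)\<^sup>2 \<le> \<alpha> / 2 * (1 / \<tau>) * (norm a)\<^sup>2"
    by (rule mult_right_mono) simp
  then have 5: "L / 2 * \<alpha>\<^sup>2 * (norm a)\<^sup>2 \<le> \<alpha> / (2 * \<tau>) * (norm a)\<^sup>2"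
    by (simp add: power2_eq_square mult_ac)
  have 6: "\<alpha> * ((a \<bullet> b) / \<tau>)
     = \<alpha> / (2 * \<tau>) * (norm a)\<^sup>2 + \<alpha> / (2 * \<tau>) * (norm b)\<^sup>2 - \<alpha> / (2 * \<tau>) * (norm (b - a))\<^sup>2"
    unfolding pol by (simp add: algebra_simps add_divide_distrib diff_divide_distrib)
  have nY: "(norm (Y' - p))\<^sup>2 = (1 - \<alpha>)\<^sup>2 * (norm b)\<^sup>2"
    unfolding d1 by (simp add: power_mult_distrib)
  have 7: "\<alpha> / (2 * \<tau>) * (norm (Y' - p))\<^sup>2 + \<alpha> * (2 - \<alpha>) / 2 * (\<alpha> / \<tau> - M) * (norm b)\<^sup>2
     = \<alpha> / (2 * \<tau>) * (norm b)\<^sup>2 - \<alpha> * (2 - \<alpha>) / 2 * M * (norm b)\<^sup>2"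
    using \<tau>(1) unfolding nY by (simp add: field_simps power2_eq_square)
  have 8: "\<alpha> * (1 - \<alpha>) * (M / 2) * (norm b)\<^sup>2 + \<alpha> * (M / 2 * (norm b)\<^sup>2) = \<alpha> * (2 - \<alpha>) / 2 * M * (norm b)\<^sup>2"
    by (simp add: field_simps)
  show ?thesis
    using 1 2 3 4 5 6 7 8 mid unfolding Yx b_def[symmetric]
    by (simp only: distrib_left right_diff_distrib left_diff_distrib)
qed

section \<open>The relaxed proximal gradient iteration\<close>

locale relaxed_proximal_gradient =
  fixes f \<phi> :: "'a::euclidean_space \<Rightarrow> ereal" and L M \<alpha> \<tau> :: real and x y q :: "nat \<Rightarrow> 'a"
  assumes f: "bounded_from_below f" "convex_fun f" "smooth_fun L f"
    and \<phi>: "proper_fun \<phi>" "lsc_fun \<phi>" "bounded_from_below \<phi>" "weakly_convex M \<phi>"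
    and \<alpha>: "0 < \<alpha>" "\<alpha> < 1"
    and \<tau>: "0 < \<tau>" "\<tau> * (\<alpha> * L) \<le> 1" "\<tau> * M < \<alpha>"
    and q: "\<And>k. q (Suc k) = (1 - \<alpha>) *\<^sub>R y k + \<alpha> *\<^sub>R x k"
    and x: "\<And>k. x (Suc k) = Prox \<tau> \<phi> (x k - \<tau> *\<^sub>R grad f (q (Suc k)))"
    and y: "\<And>k. y (Suc k) = (1 - \<alpha>) *\<^sub>R y k + \<alpha> *\<^sub>R x (Suc k)"
begin

definition g :: "'a \<Rightarrow> real" where "g z = real_of_ereal (f z)"

definition h :: "'a \<Rightarrow> real" where "h z = real_of_ereal (\<phi> z)"

definition energy :: "'a \<Rightarrow> 'a \<Rightarrow> real" where
  "energy Y u = g Y + h Y + \<alpha> / (2 * \<tau>) * (norm (Y - u))\<^sup>2"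

text \<open>
  The coefficient of the guaranteed decrease; the bound on \<open>\<tau> M\<close> is exactly its positivity.
\<close>

definition decay :: real where
  "decay = \<alpha> * (2 - \<alpha>) / 2 * (\<alpha> / \<tau> - M)"

lemma decay_pos: "0 < decay"
proof -
  have "M < \<alpha> / \<tau>" using \<tau> by (simp add: field_simps)
  then show ?thesis using \<alpha> by (simp add: decay_def)
qed

lemma f_real: "f z = ereal (g z)"
  using f(3) unfolding smooth_fun_def g_def by (simp add: ereal_real)

lemma \<phi>_real: "\<phi> z \<noteq> \<infinity> \<Longrightarrow> \<phi> z = ereal (h z)"
  using \<phi>(1) unfolding proper_fun_def h_def by (cases "\<phi> z") auto

lemma g_GDERIV: "GDERIV g w :> grad f w"
  using GDERIV_grad[OF f(3)] unfolding g_def[abs_def] .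

lemma grad_lipschitz: "L-lipschitz_on UNIV (grad f)"
  using f(3) unfolding smooth_fun_def by blast

lemma f_lower: "g w + grad f w \<bullet> (z - w) \<le> g z"
proof (rule convex_gradient_lower_bound[OF g_GDERIV])
  fix t :: real assume t: "0 \<le> t" "t \<le> 1"
  then have "f ((1 - t) *\<^sub>R w + t *\<^sub>R z) \<le> ereal (1 - t) * f w + ereal t * f z"
    using f(2) unfolding convex_fun_def by auto
  then show "g ((1 - t) *\<^sub>R w + t *\<^sub>R z) \<le> (1 - t) * g w + t * g z"
    by (simp add: f_real)
qed

text \<open>
  The point \<open>w\<close> where the gradient is evaluated is left free, so that the lemma applies to \<open>y\<close> itself
  (with \<open>w\<close> the extrapolated point) and to the shadow sequence.
\<close>

lemma energy_step:
  assumes "\<phi> Y \<noteq> \<infinity>" and p: "p = Prox \<tau> \<phi> (u - \<tau> *\<^sub>R grad f w)"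
    and Y': "Y' = (1 - \<alpha>) *\<^sub>R Y + \<alpha> *\<^sub>R p"
  shows "\<phi> Y' \<noteq> \<infinity>"
    and "energy Y' p + decay * (norm (Y - p))\<^sup>2
      \<le> energy Y u + \<alpha> * L * norm (w - ((1 - \<alpha>) *\<^sub>R Y + \<alpha> *\<^sub>R u)) * norm (Y - p)"
proof -
  have p_fin: "\<phi> p \<noteq> \<infinity>" unfolding p by (rule Prox_finite[OF \<phi>(1-3) \<tau>(1)])
  have notm: "\<And>z. \<phi> z \<noteq> -\<infinity>" using \<phi>(1) unfolding proper_fun_def by auto
  have mid: "\<phi> Y' \<le> ereal ((1 - \<alpha>) * h Y + \<alpha> * h p + \<alpha> * (1 - \<alpha>) * (M / 2) * (norm (Y - p))\<^sup>2)"
    unfolding Y' h_def using \<alpha> by (intro weakly_convex_ineq[OF \<phi>(4) notm assms(1) p_fin]) auto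
  then show Y'_fin: "\<phi> Y' \<noteq> \<infinity>" by auto
  have sub: "\<phi> p + ereal (((u - \<tau> *\<^sub>R grad f w - p) /\<^sub>R \<tau>) \<bullet> (Y - p) - M / 2 * (norm (Y - p))\<^sup>2) \<le> \<phi> Y"
    unfolding p by (rule Prox_quadratic_minorant[OF \<phi> \<tau>(1)])
  show "energy Y' p + decay * (norm (Y - p))\<^sup>2
      \<le> energy Y u + \<alpha> * L * norm (w - ((1 - \<alpha>) *\<^sub>R Y + \<alpha> *\<^sub>R u)) * norm (Y - p)"
    unfolding energy_def decay_def Y'
  proof (rule relaxed_step_descent[OF \<alpha> \<tau>(1,2)])
    show "norm (grad f w - grad f ((1 - \<alpha>) *\<^sub>R Y + \<alpha> *\<^sub>R u)) \<le> L * norm (w - ((1 - \<alpha>) *\<^sub>R Y + \<alpha> *\<^sub>R u))"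
      using lipschitz_onD[OF grad_lipschitz] by (simp add: dist_norm)
    show "h ((1 - \<alpha>) *\<^sub>R Y + \<alpha> *\<^sub>R p)
        \<le> (1 - \<alpha>) * h Y + \<alpha> * h p + \<alpha> * (1 - \<alpha>) * (M / 2) * (norm (Y - p))\<^sup>2"
      using mid unfolding \<phi>_real[OF Y'_fin] unfolding Y' by simp
    show "h p + ((u - \<tau> *\<^sub>R grad f w - p) /\<^sub>R \<tau>) \<bullet> (Y - p) - M / 2 * (norm (Y - p))\<^sup>2 \<le> h Y"
      using sub unfolding \<phi>_real[OF p_fin] \<phi>_real[OF assms(1)] by simp
  qed (rule f_lower smooth_upper_bound[OF g_GDERIV grad_lipschitz])+
qed

lemma lower_bounds:
  obtains c\<^sub>f c\<^sub>\<phi> where "\<And>z. c\<^sub>f \<le> g z" "\<And>z. \<phi> z \<noteq> \<infinity> \<Longrightarrow> c\<^sub>\<phi> \<le> h z"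
proof -
  obtain a b where "\<And>z. ereal a \<le> f z" "\<And>z. ereal b \<le> \<phi> z"
    using f(1) \<phi>(3) unfolding bounded_from_below_def by auto
  then show ?thesis using that[of a b] by (metis f_real \<phi>_real ereal_less_eq(3))
qed

text \<open>
  The solution of the recursion for \<open>y\<close> that starts at \<open>x 1\<close> instead of \<open>y 1\<close>: the recursion is
  affine with factor \<open>1 - \<alpha>\<close>, so two solutions differ by a geometric sequence. Its index is shifted
  by one, since \<open>x 0\<close> is arbitrary and \<open>x 1\<close> is the first proximal point.
\<close>

definition shadow :: "nat \<Rightarrow> 'a" where
  "shadow k = y (Suc k) - (1 - \<alpha>) ^ k *\<^sub>R (y 1 - x 1)"

lemma shadow_Suc: "shadow (Suc k) = (1 - \<alpha>) *\<^sub>R shadow k + \<alpha> *\<^sub>R x (Suc (Suc k))"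
  unfolding shadow_def by (subst y) (simp add: algebra_simps)

lemma extrapolation_error:
  "q (Suc (Suc k)) - ((1 - \<alpha>) *\<^sub>R shadow k + \<alpha> *\<^sub>R x (Suc k)) = (1 - \<alpha>) ^ Suc k *\<^sub>R (y 1 - x 1)"
  unfolding shadow_def by (subst q) (simp add: algebra_simps)

lemma shadow_finite: "\<phi> (shadow k) \<noteq> \<infinity>"
proof (induction k)
  case 0
  have "shadow 0 = x 1" by (simp add: shadow_def)
  then show ?case using x[of 0] Prox_finite[OF \<phi>(1-3) \<tau>(1)] by simp
next
  case (Suc k)
  show ?case by (rule energy_step(1)[OF Suc.IH x shadow_Suc])
qed

text \<open>
  By Young's inequality, the error term \<open>\<epsilon> k * d k\<close> from the displaced gradient is at most half of the
  decrease plus a multiple of \<open>(\<epsilon> k)\<^sup>2\<close>, which is geometric.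
\<close>

lemma shadow_energy:
  shows shadow_summable: "summable (\<lambda>k. (norm (shadow k - x (Suc (Suc k))))\<^sup>2)"
    and shadow_energy_bounded: "\<exists>B. \<forall>k. energy (shadow k) (x (Suc k)) \<le> B"
proof -
  define \<epsilon> where "\<epsilon> k = \<alpha> * L * ((1 - \<alpha>) ^ Suc k * norm (y 1 - x 1))" for k
  define d where "d k = norm (shadow k - x (Suc (Suc k)))" for k
  define E where "E k = energy (shadow k) (x (Suc k))" for k
  have step: "E (Suc k) + decay / 2 * (d k)\<^sup>2 \<le> E k + (\<epsilon> k)\<^sup>2 / (2 * decay)" for k
  proof -
    have "E (Suc k) + decay * (d k)\<^sup>2 \<le> E k + \<epsilon> k * d k"
      using energy_step(2)[OF shadow_finite x shadow_Suc, of k]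
      unfolding extrapolation_error E_def d_def \<epsilon>_def using \<alpha> by (simp add: mult.assoc)
    moreover have "\<epsilon> k * d k \<le> decay / 2 * (d k)\<^sup>2 + (\<epsilon> k)\<^sup>2 / (2 * decay)"
    proof -
      have "0 \<le> (decay * d k - \<epsilon> k)\<^sup>2 / (2 * decay)" using decay_pos by simp
      also have "\<dots> = decay / 2 * (d k)\<^sup>2 + (\<epsilon> k)\<^sup>2 / (2 * decay) - \<epsilon> k * d k"
        using decay_pos by (simp add: power2_diff field_simps power2_eq_square)
      finally show ?thesis by simp
    qed
    ultimately show ?thesis by linarith
  qed
  have "(\<lambda>k. (\<epsilon> k)\<^sup>2 / (2 * decay))
      = (\<lambda>k. ((\<alpha> * L * (1 - \<alpha>) * norm (y 1 - x 1))\<^sup>2 / (2 * decay)) * ((1 - \<alpha>)\<^sup>2) ^ k)"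
    by (rule ext) (simp add: \<epsilon>_def power_mult_distrib power_mult[symmetric] mult.commute mult.left_commute power_commutes)
  moreover have "(1 - \<alpha>)\<^sup>2 < 1" using \<alpha> by (simp add: abs_square_less_1)
  then have "summable (\<lambda>k. ((\<alpha> * L * (1 - \<alpha>) * norm (y 1 - x 1))\<^sup>2 / (2 * decay)) * ((1 - \<alpha>)\<^sup>2) ^ k)"
    by (intro summable_mult summable_geometric) simp
  ultimately have b: "summable (\<lambda>k. (\<epsilon> k)\<^sup>2 / (2 * decay))" by (simp only:)
  obtain c\<^sub>f c\<^sub>\<phi> where c: "\<And>z. c\<^sub>f \<le> g z" "\<And>z. \<phi> z \<noteq> \<infinity> \<Longrightarrow> c\<^sub>\<phi> \<le> h z"
    using lower_bounds by blast
  have E: "c\<^sub>f + c\<^sub>\<phi> \<le> E k" for k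
    unfolding E_def energy_def using c(1)[of "shadow k"] c(2)[OF shadow_finite, of k] \<alpha> \<tau>(1)
    by (intro add_increasing2 add_mono) auto
  have nonneg: "0 \<le> decay / 2 * (d k)\<^sup>2" "0 \<le> (\<epsilon> k)\<^sup>2 / (2 * decay)" for k
    using decay_pos by auto
  have "summable (\<lambda>k. decay / 2 * (d k)\<^sup>2)"
    by (rule quasi_descent(1)[OF step nonneg b E])
  then show "summable (\<lambda>k. (norm (shadow k - x (Suc (Suc k))))\<^sup>2)"
    using decay_pos by (simp add: summable_cmult_iff d_def)
  show "\<exists>B. \<forall>k. energy (shadow k) (x (Suc k)) \<le> B"
    using quasi_descent(2)[OF step nonneg b E] unfolding E_def by blast
qed

lemma y_increment: "y (Suc k) - y k = \<alpha> *\<^sub>R (x (Suc k) - y k)"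
  by (subst y) (simp add: algebra_simps)

text \<open>
  Up to the factor \<open>\<alpha>\<close>, the increments are the gaps between \<open>y\<close> and the next \<open>x\<close>, which differ from
  those of the shadow sequence by a geometric sequence.
\<close>

lemma summable_increments: "summable (\<lambda>k. (norm (y (Suc k) - y k))\<^sup>2)"
proof -
  define e where "e = y 1 - x 1"
  have bound: "(norm (y (Suc (Suc k)) - y (Suc k)))\<^sup>2
      \<le> 2 * (norm (shadow k - x (Suc (Suc k))))\<^sup>2 + 2 * (norm e)\<^sup>2 * ((1 - \<alpha>)\<^sup>2) ^ k" for k
  proof -
    let ?a = "shadow k - x (Suc (Suc k))" and ?b = "(1 - \<alpha>) ^ k *\<^sub>R e"
    have "y (Suc (Suc k)) - y (Suc k) = - \<alpha> *\<^sub>R (?a + ?b)"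
      by (simp add: y_increment shadow_def e_def algebra_simps)
    then have "norm (y (Suc (Suc k)) - y (Suc k)) \<le> norm (?a + ?b)"
      using \<alpha> by (simp add: mult_left_le_one_le)
    also have "\<dots> \<le> norm ?a + norm ?b" by (rule norm_triangle_ineq)
    finally have "(norm (y (Suc (Suc k)) - y (Suc k)))\<^sup>2 \<le> (norm ?a + norm ?b)\<^sup>2"
      by (rule power_mono) simp
    also have "\<dots> \<le> 2 * (norm ?a)\<^sup>2 + 2 * (norm ?b)\<^sup>2"
      using sum_squares_bound[of "norm ?a" "norm ?b"] by (simp add: power2_sum)
    also have "(norm ?b)\<^sup>2 = (norm e)\<^sup>2 * ((1 - \<alpha>)\<^sup>2) ^ k"
      by (simp add: power_mult_distrib power_mult[symmetric] mult.commute)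
    finally show ?thesis by simp
  qed
  have "(1 - \<alpha>)\<^sup>2 < 1" using \<alpha> by (simp add: abs_square_less_1)
  then have "summable (\<lambda>k. 2 * (norm (shadow k - x (Suc (Suc k))))\<^sup>2 + 2 * (norm e)\<^sup>2 * ((1 - \<alpha>)\<^sup>2) ^ k)"
    by (intro summable_add summable_mult shadow_summable summable_geometric) simp
  then have "summable (\<lambda>k. (norm (y (Suc (Suc k)) - y (Suc k)))\<^sup>2)"
  proof (rule summable_comparison_test'[where N = 0])
    show "norm ((norm (y (Suc (Suc k)) - y (Suc k)))\<^sup>2)
        \<le> 2 * (norm (shadow k - x (Suc (Suc k))))\<^sup>2 + 2 * (norm e)\<^sup>2 * ((1 - \<alpha>)\<^sup>2) ^ k" for k
      using bound[of k] by simp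
  qed
  then show ?thesis by (subst (asm) summable_Suc_iff)
qed

lemma increments_tendsto_0: "(\<lambda>k. y (Suc k) - y k) \<longlonglongrightarrow> 0"
proof -
  have "(\<lambda>k. sqrt ((norm (y (Suc k) - y k))\<^sup>2)) \<longlonglongrightarrow> sqrt 0"
    by (intro tendsto_real_sqrt summable_LIMSEQ_zero summable_increments)
  then show ?thesis by (simp add: tendsto_norm_zero_iff)
qed

lemma prox_gap_tendsto_0: "(\<lambda>k. x (Suc k) - y k) \<longlonglongrightarrow> 0"
proof -
  have "(\<lambda>k. (1 / \<alpha>) *\<^sub>R (y (Suc k) - y k)) \<longlonglongrightarrow> (1 / \<alpha>) *\<^sub>R 0"
    by (intro tendsto_intros increments_tendsto_0)
  then show ?thesis using \<alpha> by (simp add: y_increment)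
qed

lemma x_gap_tendsto_0: "(\<lambda>k. x k - y k) \<longlonglongrightarrow> 0"
proof -
  have "(\<lambda>k. (x (Suc k) - y k) - (y (Suc k) - y k)) \<longlonglongrightarrow> 0 - 0"
    by (intro tendsto_diff prox_gap_tendsto_0 increments_tendsto_0)
  then have "(\<lambda>k. x (Suc k) - y (Suc k)) \<longlonglongrightarrow> 0" by simp
  then show ?thesis by (rule LIMSEQ_imp_Suc)
qed

text \<open>
  The points \<open>u n = x (Suc (r n))\<close> are proximal points that converge to \<open>p\<close> together with \<open>y \<circ> r\<close>. The
  optimality condition provides subgradients \<open>v n\<close> of \<open>\<phi>\<close> at \<open>u n\<close>; as \<open>x\<close>, \<open>q\<close> and \<open>u\<close> all converge to
  \<open>p\<close>, these tend to \<open>- grad f p\<close>.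
\<close>

lemma cluster_point_stationary:
  assumes "cluster_point y p"
  shows "stationary_point (\<lambda>z. f z + \<phi> z) p"
proof -
  obtain r where r: "strict_mono r" and "(y \<circ> r) \<longlonglongrightarrow> p"
    using assms unfolding cluster_point_def by blast
  then have yr: "(\<lambda>n. y (r n)) \<longlonglongrightarrow> p" by (simp add: o_def)
  have near: "(\<lambda>n. s (r n)) \<longlonglongrightarrow> p" if "(\<lambda>k. s k - y k) \<longlonglongrightarrow> 0" for s
  proof -
    have "(\<lambda>n. (s (r n) - y (r n)) + y (r n)) \<longlonglongrightarrow> 0 + p"
      by (intro tendsto_add yr) (use LIMSEQ_subseq_LIMSEQ[OF that r] in \<open>simp add: o_def\<close>)
    then show ?thesis by simp
  qed
  have xr: "(\<lambda>n. x (r n)) \<longlonglongrightarrow> p" by (rule near[OF x_gap_tendsto_0])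
  define u where "u n = x (Suc (r n))" for n
  have u: "u \<longlonglongrightarrow> p" unfolding u_def by (rule near[OF prox_gap_tendsto_0])
  have "(\<lambda>n. (1 - \<alpha>) *\<^sub>R y (r n) + \<alpha> *\<^sub>R x (r n)) \<longlonglongrightarrow> (1 - \<alpha>) *\<^sub>R p + \<alpha> *\<^sub>R p"
    by (intro tendsto_intros xr yr)
  then have qr: "(\<lambda>n. q (Suc (r n))) \<longlonglongrightarrow> p" by (simp add: q algebra_simps)
  have grad_lim: "(\<lambda>n. grad f (s n)) \<longlonglongrightarrow> grad f p" if "s \<longlonglongrightarrow> p" for s
    using continuous_on_tendsto_compose[OF lipschitz_on_continuous_on[OF grad_lipschitz] that] by simp
  define v where "v n = (x (r n) - \<tau> *\<^sub>R grad f (q (Suc (r n))) - u n) /\<^sub>R \<tau>" for n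
  have "v \<longlonglongrightarrow> (p - \<tau> *\<^sub>R grad f p - p) /\<^sub>R \<tau>"
    unfolding v_def by (intro tendsto_intros xr u grad_lim qr)
  then have v: "v \<longlonglongrightarrow> - grad f p" using \<tau>(1) by simp
  have minorant: "\<phi> (u n) + ereal (v n \<bullet> (z - u n) - M / 2 * (norm (z - u n))\<^sup>2) \<le> \<phi> z" for n z
    unfolding u_def v_def x[of "r n"] by (rule Prox_quadratic_minorant[OF \<phi> \<tau>(1)])
  note lim = quadratic_minorant_limit[OF \<phi>(1,2) minorant u v]
  have "(\<lambda>n. g (u n)) \<longlonglongrightarrow> g p"
  proof -
    have "isCont g p"
      using g_GDERIV unfolding gderiv_def by (rule has_derivative_continuous)
    then show ?thesis using u by (rule isCont_tendsto_compose)
  qed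
  then have "(\<lambda>n. f (u n)) \<longlonglongrightarrow> f p" by (simp add: f_real[of "u _"] f_real[of p])
  then have F_lim: "(\<lambda>n. f (u n) + \<phi> (u n)) \<longlonglongrightarrow> f p + \<phi> p"
    using lim by (intro tendsto_add_ereal) (auto simp: f_real[of p])
  have "grad f (u n) + v n \<in> frechet_subdiff (\<lambda>z. f z + \<phi> z) (u n)" for n
  proof (rule frechet_subdiff_quadratic_minorant)
    have fin: "\<phi> (u n) \<noteq> \<infinity>"
      unfolding u_def x[of "r n"] by (rule Prox_finite[OF \<phi>(1-3) \<tau>(1)])
    show "\<bar>f (u n) + \<phi> (u n)\<bar> \<noteq> \<infinity>"
      by (simp add: f_real[of "u n"] \<phi>_real[OF fin])
    fix z
    show "f (u n) + \<phi> (u n) + ereal ((grad f (u n) + v n) \<bullet> (z - u n) - M / 2 * (norm (z - u n))\<^sup>2)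
        \<le> f z + \<phi> z"
      using f_lower[of "u n" z] minorant[of n z]
      unfolding f_real[of z] f_real[of "u n"] \<phi>_real[OF fin]
      by (cases "\<phi> z") (auto simp: inner_add_left)
  qed
  moreover have "(\<lambda>n. grad f (u n) + v n) \<longlonglongrightarrow> grad f p + - grad f p"
    by (intro tendsto_add grad_lim u v)
  then have "(\<lambda>n. grad f (u n) + v n) \<longlonglongrightarrow> 0" by simp
  moreover have "\<bar>f p + \<phi> p\<bar> \<noteq> \<infinity>" using lim(1) by (auto simp: f_real[of p])
  ultimately show ?thesis
    unfolding stationary_point_def limiting_subdiff_def using u F_lim by blast
qed

text \<open>
  The energy of the shadow sequence is bounded, and \<open>f\<close> is bounded below, so \<open>\<phi>\<close> is bounded along
  the shadow sequence.
\<close>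

lemma coercive_bounded:
  assumes "coercive \<phi>"
  shows "bounded (range (\<lambda>k. y (Suc k)))"
proof -
  obtain B where B: "\<And>k. energy (shadow k) (x (Suc k)) \<le> B"
    using shadow_energy_bounded by blast
  obtain c\<^sub>f c\<^sub>\<phi> where c: "\<And>z. c\<^sub>f \<le> g z" "\<And>z. \<phi> z \<noteq> \<infinity> \<Longrightarrow> c\<^sub>\<phi> \<le> h z"
    using lower_bounds by blast
  have h_le: "h (shadow k) \<le> B - c\<^sub>f" for k
  proof -
    have "0 \<le> \<alpha> / (2 * \<tau>) * (norm (shadow k - x (Suc k)))\<^sup>2" using \<alpha> \<tau>(1) by simp
    then show ?thesis using B[of k] c(1)[of "shadow k"] unfolding energy_def by linarith
  qed
  have "eventually (\<lambda>z. ereal (B - c\<^sub>f) < \<phi> z) at_infinity"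
    using assms unfolding coercive_def by (rule order_tendstoD) simp
  then obtain R where R: "\<And>z. R \<le> norm z \<Longrightarrow> ereal (B - c\<^sub>f) < \<phi> z"
    unfolding eventually_at_infinity by blast
  have shadow: "norm (shadow k) \<le> R" for k
    using R[of "shadow k"] h_le[of k] \<phi>_real[OF shadow_finite, of k] by (metis ereal_less_eq(3) linear not_le)
  have "norm (y (Suc k)) \<le> R + norm (y 1 - x 1)" for k
  proof -
    have "y (Suc k) = shadow k + (1 - \<alpha>) ^ k *\<^sub>R (y 1 - x 1)" by (simp add: shadow_def)
    then have "norm (y (Suc k)) \<le> norm (shadow k) + norm ((1 - \<alpha>) ^ k *\<^sub>R (y 1 - x 1))"
      by (metis norm_triangle_ineq)
    also have "\<dots> \<le> R + norm (y 1 - x 1)"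
      using \<alpha> by (intro add_mono shadow) (simp add: mult_left_le_one_le power_le_one)
    finally show ?thesis .
  qed
  then show ?thesis by (auto simp: bounded_iff)
qed

definition merit :: "nat \<Rightarrow> ereal" where
  "merit k = f (y (Suc k)) + \<phi> (y (Suc k))
       + ereal (\<alpha> / (2 * \<tau>) * (1 - 1 / \<alpha>)\<^sup>2 * (norm (y (Suc k) - y k))\<^sup>2)"

text \<open>
  Both \<open>y (Suc k) - y k\<close> and \<open>y (Suc k) - x (Suc k)\<close> are multiples of \<open>x (Suc k) - y k\<close>.
\<close>

lemma momentum_term:
  "\<alpha> / (2 * \<tau>) * (1 - 1 / \<alpha>)\<^sup>2 * (norm (y (Suc k) - y k))\<^sup>2
   = \<alpha> / (2 * \<tau>) * (norm (y (Suc k) - x (Suc k)))\<^sup>2"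
proof -
  have "y (Suc k) - x (Suc k) = (1 - 1 / \<alpha>) *\<^sub>R (y (Suc k) - y k)"
    unfolding y_increment using \<alpha> by (subst y) (simp add: algebra_simps)
  then show ?thesis by (simp add: power_mult_distrib)
qed

lemma merit_eq_energy:
  "\<phi> (y (Suc k)) \<noteq> \<infinity> \<Longrightarrow> merit k = ereal (energy (y (Suc k)) (x (Suc k)))"
  unfolding merit_def momentum_term energy_def f_real[of "y (Suc k)"] by (simp add: \<phi>_real)

text \<open>
  Outside the domain of \<open>\<phi>\<close> the value is \<open>\<infinity>\<close>, so nothing is to be shown for the next one; inside,
  the gradient is taken at the extrapolated point and the error term of \<open>energy_step\<close> is \<open>0\<close>.
\<close>

lemma decseq_merit: "decseq merit"
proof (rule decseq_SucI)
  fix k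
  show "merit (Suc k) \<le> merit k"
  proof (cases "\<phi> (y (Suc k)) = \<infinity>")
    case True
    then show ?thesis by (simp add: merit_def f_real[of "y (Suc k)"])
  next
    case False
    note step = energy_step[OF False x y]
    have "0 \<le> decay * (norm (y (Suc k) - x (Suc (Suc k))))\<^sup>2" using decay_pos by simp
    then have "energy (y (Suc (Suc k))) (x (Suc (Suc k))) \<le> energy (y (Suc k)) (x (Suc k))"
      using step(2) by (simp add: q)
    then show ?thesis using merit_eq_energy False step(1) by simp
  qed
qed

lemma merit_converges:
  "\<exists>l. merit \<longlonglongrightarrow> l \<and> l \<noteq> -\<infinity> \<and> ((\<exists>k. f (y k) + \<phi> (y k) < \<infinity>) \<longrightarrow> l < \<infinity>)"
proof (intro exI conjI impI)
  let ?l = "INF k. merit k"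
  show "merit \<longlonglongrightarrow> ?l" by (rule LIMSEQ_INF[OF decseq_merit])
  obtain c\<^sub>f c\<^sub>\<phi> where c: "\<And>z. c\<^sub>f \<le> g z" "\<And>z. \<phi> z \<noteq> \<infinity> \<Longrightarrow> c\<^sub>\<phi> \<le> h z"
    using lower_bounds by blast
  have "ereal (c\<^sub>f + c\<^sub>\<phi>) \<le> merit k" for k
  proof (cases "\<phi> (y (Suc k)) = \<infinity>")
    case True
    then show ?thesis by (simp add: merit_def f_real[of "y (Suc k)"])
  next
    case False
    have "0 \<le> \<alpha> / (2 * \<tau>) * (norm (y (Suc k) - x (Suc k)))\<^sup>2" using \<alpha> \<tau>(1) by simp
    then show ?thesis
      using c(1)[of "y (Suc k)"] c(2)[OF False] unfolding merit_eq_energy[OF False] energy_def by simp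
  qed
  then have "ereal (c\<^sub>f + c\<^sub>\<phi>) \<le> ?l" by (intro INF_greatest)
  then show "?l \<noteq> -\<infinity>" by auto
  assume "\<exists>k. f (y k) + \<phi> (y k) < \<infinity>"
  then obtain k where "\<phi> (y k) \<noteq> \<infinity>" by (auto simp: f_real)
  then have "\<phi> (y (Suc k)) \<noteq> \<infinity>" using energy_step(1)[OF _ x y] by blast
  then have "merit k < \<infinity>" by (simp add: merit_eq_energy)
  moreover have "?l \<le> merit k" by (rule INF_lower) simp
  ultimately show "?l < \<infinity>" by (rule le_less_trans[rotated])
qed

end

theorem theorem2:
  fixes f \<phi> F :: "real ^ 'n \<Rightarrow> ereal"
    and L\<^sub>f M \<alpha> \<tau> :: real
    and x y q :: "nat \<Rightarrow> real ^ 'n"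
  assumes f: "proper_fun f" "lsc_fun f" "bounded_from_below f"
    and f_convex: "convex_fun f"
    and f_smooth: "smooth_fun L\<^sub>f f"
    and \<phi>: "proper_fun \<phi>" "lsc_fun \<phi>" "bounded_from_below \<phi>"
    and \<phi>_weakly_convex: "weakly_convex M \<phi>"
    and F: "F = (\<lambda>z. f z + \<phi> z)"
    and \<alpha>: "0 < \<alpha>" "\<alpha> < 1"
    and \<tau>: "0 < \<tau>" "ereal \<tau> < min (1 / ereal (\<alpha> * L\<^sub>f)) (ereal \<alpha> / ereal M)"
    and q: "\<And>k. q (Suc k) = (1 - \<alpha>) *\<^sub>R y k + \<alpha> *\<^sub>R x k"
    and x: "\<And>k. x (Suc k) = Prox \<tau> \<phi> (x k - \<tau> *\<^sub>R grad f (q (Suc k)))"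
    and y: "\<And>k. y (Suc k) = (1 - \<alpha>) *\<^sub>R y k + \<alpha> *\<^sub>R x (Suc k)"
  shows
    "(let V = (\<lambda>k. F (y (Suc k)) +
                 ereal (\<alpha> / (2 * \<tau>) * (1 - 1 / \<alpha>)\<^sup>2 * (norm (y (Suc k) - y k))\<^sup>2))
      in decseq V \<and>
         (\<exists>l. V \<longlonglongrightarrow> l \<and> l \<noteq> -\<infinity> \<and> ((\<exists>k. F (y k) < \<infinity>) \<longrightarrow> l < \<infinity>))) \<and>
     (summable (\<lambda>k. (norm (y (Suc k) - y k))\<^sup>2) \<and>
      (\<lambda>k. norm (y (Suc k) - y k)) \<longlonglongrightarrow> 0 \<and>
      (\<lambda>K. Min ((\<lambda>k. norm (y (Suc k) - y k)) ` {..<K})) \<in> O(\<lambda>K. 1 / sqrt (real K))) \<and>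
     ((\<forall>p. cluster_point y p \<longrightarrow> stationary_point F p) \<and>
      (coercive \<phi> \<longrightarrow>
        (\<exists>p r. strict_mono r \<and> (y \<circ> r) \<longlonglongrightarrow> p \<and> stationary_point F p)))"
proof -
  have "0 \<le> L\<^sub>f" using f_smooth lipschitz_on_nonneg unfolding smooth_fun_def by blast
  \<comment> \<open>For \<open>L\<^sub>f = 0\<close> or \<open>M = 0\<close> the quotient is \<open>\<infinity>\<close>, and the real inequality is trivial.\<close>
  have \<tau>_L: "\<tau> * (\<alpha> * L\<^sub>f) \<le> 1"
  proof (cases "L\<^sub>f = 0")
    case False
    then have "0 < \<alpha> * L\<^sub>f" using \<open>0 \<le> L\<^sub>f\<close> \<alpha> by simp
    then show ?thesis using \<tau>(2) False \<alpha>(1)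
      by (simp add: one_ereal_def pos_less_divide_eq)
  qed simp
  have \<tau>_M: "\<tau> * M < \<alpha>"
  proof (cases "M \<le> 0")
    case True
    then show ?thesis using \<tau>(1) \<alpha>(1) by (meson mult_nonneg_nonpos less_imp_le le_less_trans)
  next
    case False
    then show ?thesis using \<tau>(2) by (simp add: pos_less_divide_eq)
  qed
  interpret relaxed_proximal_gradient f \<phi> L\<^sub>f M \<alpha> \<tau> x y q
    by unfold_locales (fact f f_convex f_smooth \<phi> \<phi>_weakly_convex \<alpha> \<tau>(1) \<tau>_L \<tau>_M q x y)+
  have merit: "merit = (\<lambda>k. F (y (Suc k)) +
                 ereal (\<alpha> / (2 * \<tau>) * (1 - 1 / \<alpha>)\<^sup>2 * (norm (y (Suc k) - y k))\<^sup>2))"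
    by (simp add: merit_def F fun_eq_iff)
  have subseq: "\<exists>p r. strict_mono r \<and> (y \<circ> r) \<longlonglongrightarrow> p \<and> stationary_point F p" if coercive: "coercive \<phi>"
  proof -
    obtain p r where r: "strict_mono r" and lim: "((\<lambda>k. y (Suc k)) \<circ> r) \<longlonglongrightarrow> p"
      using bounded_imp_convergent_subsequence[OF coercive_bounded[OF coercive]] by blast
    have "strict_mono (Suc \<circ> r)" using r by (simp add: strict_mono_def)
    moreover have "(y \<circ> (Suc \<circ> r)) \<longlonglongrightarrow> p" using lim by (simp add: o_def)
    ultimately show ?thesis
      using cluster_point_stationary unfolding F cluster_point_def by blast
  qed
  show ?thesis
    unfolding Let_def merit[symmetric]
    using decseq_merit merit_converges summable_increments tendsto_norm_zero[OF increments_tendsto_0]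
      Min_bigo_of_square_summable[OF norm_ge_zero summable_increments]
      cluster_point_stationary subseq
    unfolding F by blast
qed

end
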